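(* Let $f$ be a polynomial and let $m\ge 1$ be an integer. Then, as polynomials in $x$, $$(x+1)^m f(\mathbf{F}_{\mathbf{x}})-x^m f(\mathbf{F}_{\mathbf{x}}+m)=\sum_{k=0}^{m-1} f(k)\,(x+1)^{m-1-k}x^k.$$
   Context: ${n\brace k}$ denotes the Stirling numbers of the second kind and $\mathcal{F}_n(x)=\sum_{k=0}^n {n\brace k}k!\,x^k$ the Fubini polynomials. Umbral notation: for a polynomial $h(u)=\sum_k c_k u^k$ in an indeterminate $u$, $h(\mathbf{F}_{\mathbf{x}}):=\sum_k c_k\mathcal{F}_k(x)$, i.e. the image of $h$ under the linear map $u^k\mapsto\mathcal{F}_k(x)$; thus $f(\mathbf{F}_{\mathbf{x}}+m)$ means the polynomial $f(u+m)$ expanded in powers of $u$ and then mapped by $u^k\mapsto \mathcal{F}_k(x)$. *)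

theory Defs
  imports
    "HOL-Computational_Algebra.Polynomial"
    "HOL-Combinatorics.Stirling"
begin

definition fubini_poly :: "nat \<Rightarrow> 'a::comm_ring_1 poly" where
  "fubini_poly n = (\<Sum>k\<le>n. monom (of_nat (Stirling n k * fact k)) k)"

(* The linear map u^k |-> F_k(x): its argument is a polynomial in u, its value a polynomial in x. *)
definition umbral_fubini :: "'a::comm_ring_1 poly \<Rightarrow> 'a poly" where
  "umbral_fubini h = (\<Sum>k\<le>degree h. smult (coeff h k) (fubini_poly k))"

end

theory Submission imports Defs begin

text \<open>
  Write \<open>L\<close> for the umbral map. Multiplication by \<open>u\<close> corresponds under \<open>L\<close> to the operator
  \<open>D p = x ((x + 1) p)'\<close>, because \<open>\<F>\<^sub>n\<^sub>+\<^sub>1 = D \<F>\<^sub>n\<close> is the Stirling recurrence. The case \<open>m = 1\<close>,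
  that is \<open>(x + 1) L f - x L (f(u + 1)) = f(0)\<close>, then follows by induction on \<open>f\<close>: passing from
  \<open>g\<close> to \<open>a + u g\<close> amounts to differentiating the identity for \<open>g\<close>, which kills the constant
  \<open>g(0)\<close>. The general case follows by telescoping with the shifts \<open>f(u + k)\<close>.
\<close>

text \<open>The library's derivative is restricted to rings without zero divisors, so the Euler operator
  \<open>\<theta> p = x p'\<close> is defined through its coefficients; the operator \<open>D\<close> is \<open>p \<mapsto> \<theta> ((x + 1) p)\<close>.\<close>

definition euler_op :: "'a::comm_ring_1 poly \<Rightarrow> 'a poly" where
  "euler_op p = (\<Sum>k\<le>degree p. monom (of_nat k * coeff p k) k)"

lemma coeff_euler_op: "coeff (euler_op p) k = of_nat k * coeff p k"
  by (cases "k \<le> degree p") (auto simp: euler_op_def coeff_sum coeff_eq_0)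

lemma euler_op_add: "euler_op (p + q) = euler_op p + euler_op q"
  by (rule poly_eqI) (simp add: coeff_euler_op algebra_simps)

lemma euler_op_smult: "euler_op (smult c p) = smult c (euler_op p)"
  by (rule poly_eqI) (simp add: coeff_euler_op algebra_simps)

lemma euler_op_const [simp]: "euler_op [:c:] = 0"
  by (simp add: euler_op_def)

text \<open>Leibniz rule for the derivation \<theta>, which fixes \<open>x\<close>.\<close>

lemma euler_op_mult_X: "euler_op ([:0, 1:] * p) = [:0, 1:] * (p + euler_op p)"
  by (rule poly_eqI) (simp add: coeff_euler_op coeff_pCons algebra_simps split: nat.split)

definition fubini_step :: "'a::comm_ring_1 poly \<Rightarrow> 'a poly" where
  "fubini_step p = euler_op ([:1, 1:] * p)"

lemma fubini_step_add: "fubini_step (p + q) = fubini_step p + fubini_step q"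
  by (simp add: fubini_step_def distrib_left euler_op_add del: mult_pCons_left)

lemma fubini_step_smult: "fubini_step (smult c p) = smult c (fubini_step p)"
  by (simp add: fubini_step_def euler_op_smult del: mult_pCons_left)

lemma fubini_step_0 [simp]: "fubini_step 0 = 0"
  by (simp add: fubini_step_def euler_op_def)

lemma fubini_step_sum: "fubini_step (sum h A) = (\<Sum>k\<in>A. fubini_step (h k))"
  by (induct A rule: infinite_finite_induct) (auto simp: fubini_step_add)

lemma coeff_fubini_poly: "coeff (fubini_poly n) k = of_nat (Stirling n k * fact k)"
  by (cases "k \<le> n") (auto simp: fubini_poly_def coeff_sum)

lemma fubini_poly_0: "fubini_poly 0 = 1"
  by (simp add: fubini_poly_def)

text \<open>For \<open>k > 0\<close>, coefficient \<open>k\<close> of \<open>fubini_step p\<close>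
  is \<open>k\<close> times the sum of the coefficients \<open>k\<close> and \<open>k - 1\<close> of
  \<open>p\<close>; the factor \<open>k\<close> turns \<open>fact (k - 1)\<close> into
  \<open>fact k\<close>.\<close>

lemma fubini_poly_Suc: "fubini_poly (Suc n) = fubini_step (fubini_poly n)"
proof (rule poly_eqI)
  fix k
  show "coeff (fubini_poly (Suc n)) k = coeff (fubini_step (fubini_poly n) :: 'a poly) k"
    by (cases k) (simp_all add: fubini_step_def coeff_fubini_poly coeff_euler_op algebra_simps)
qed

lemma umbral_fubini_0 [simp]: "umbral_fubini 0 = 0"
  by (simp add: umbral_fubini_def)

text \<open>A Horner-style recursion, which allows induction over \<open>pCons\<close> without
  tracking degrees.\<close>

lemma umbral_fubini_pCons: "umbral_fubini (pCons a h) = [:a:] + fubini_step (umbral_fubini h)"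
proof (cases "h = 0")
  case True
  then show ?thesis by (simp add: umbral_fubini_def fubini_poly_0)
next
  case False
  then show ?thesis
    by (simp add: umbral_fubini_def sum.atMost_Suc_shift fubini_poly_0 fubini_poly_Suc
        fubini_step_sum fubini_step_smult del: sum.atMost_Suc)
qed

lemma umbral_fubini_add: "umbral_fubini (p + q) = umbral_fubini p + umbral_fubini q"
  by (induct p q rule: poly_induct2) (simp_all add: umbral_fubini_pCons fubini_step_add)

lemma umbral_fubini_shift_one:
  fixes f :: "'a::comm_ring_1 poly"
  shows "[:1, 1:] * umbral_fubini f - [:0, 1:] * umbral_fubini (f \<circ>\<^sub>p [:1, 1:]) = [:poly f 0:]"
proof (induct f)
  case 0
  then show ?case by simp
next
  case (pCons a g)
  define x y :: "'a poly" where "x = [:0, 1:]" and "y = [:1, 1:]"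
  have y: "y = x + 1" by (simp add: x_def y_def one_pCons)
  define p q where "p = umbral_fubini g" and "q = umbral_fubini (g \<circ>\<^sub>p y)"
  have IH: "y * p = x * q + [:poly g 0:]"
    using pCons(2) unfolding p_def q_def x_def y_def by (simp add: algebra_simps)
  \<comment> \<open>Applying \<theta> to \<open>IH\<close> kills the constant
    \<open>poly g 0\<close>.\<close>
  have p: "fubini_step p = x * (q + euler_op q)"
    unfolding fubini_step_def y_def[symmetric] IH euler_op_add
    by (simp add: x_def euler_op_mult_X del: mult_pCons_left)
  have "y * q = x * q + q" by (simp add: y algebra_simps)
  then have q: "fubini_step q = x * (q + euler_op q) + euler_op q"
    unfolding fubini_step_def y_def[symmetric]
    by (simp add: euler_op_add x_def euler_op_mult_X del: mult_pCons_left)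
  have "pCons a g \<circ>\<^sub>p y = pCons a (g \<circ>\<^sub>p y) + g \<circ>\<^sub>p y"
    by (simp add: pcompose_pCons y_def)
  then have "umbral_fubini (pCons a g \<circ>\<^sub>p y) = [:a:] + fubini_step q + q"
    by (simp add: umbral_fubini_add umbral_fubini_pCons q_def)
  \<comment> \<open>By \<open>p\<close> and \<open>q\<close>, the terms free of \<open>a\<close>
    combine to \<open>x * (q + euler_op q)\<close> times \<open>y - x - 1 = 0\<close>.\<close>
  then have "y * umbral_fubini (pCons a g) - x * umbral_fubini (pCons a g \<circ>\<^sub>p y) = [:a:]"
    unfolding umbral_fubini_pCons p_def[symmetric] p q y by (simp add: algebra_simps smult_add_right smult_one)
  then show ?case by (simp add: x_def y_def)
qed

lemma umbral_fubini_shift: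
  fixes f :: "'a::comm_ring_1 poly"
  shows "[:1, 1:] ^ m * umbral_fubini f - [:0, 1:] ^ m * umbral_fubini (f \<circ>\<^sub>p [:of_nat m, 1:])
    = (\<Sum>k<m. smult (poly f (of_nat k)) ([:1, 1:] ^ (m - 1 - k) * [:0, 1:] ^ k))"
proof (induct m)
  case 0
  then show ?case by (simp add: pcompose_idR)
next
  case (Suc m)
  define x y :: "'a poly" where "x = [:0, 1:]" and "y = [:1, 1:]"
  define g where "g = f \<circ>\<^sub>p [:of_nat m, 1:]"
  have fg: "f \<circ>\<^sub>p [:of_nat (Suc m), 1:] = g \<circ>\<^sub>p y"
    by (simp add: g_def y_def pcompose_pCons add.commute flip: pcompose_assoc)
  have const: "y * umbral_fubini g - x * umbral_fubini (g \<circ>\<^sub>p y) = [:poly f (of_nat m):]"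
    unfolding x_def y_def umbral_fubini_shift_one by (simp add: g_def poly_pcompose)
  \<comment> \<open>The term \<open>y * x ^ m * umbral_fubini g\<close> is subtracted and added
    back.\<close>
  have "y ^ Suc m * umbral_fubini f
      - x ^ Suc m * umbral_fubini (f \<circ>\<^sub>p [:of_nat (Suc m), 1:])
    = y * (y ^ m * umbral_fubini f - x ^ m * umbral_fubini g) + x ^ m * [:poly f (of_nat m):]"
    unfolding fg const[symmetric] by (simp add: algebra_simps)
  also have "y ^ m * umbral_fubini f - x ^ m * umbral_fubini g
    = (\<Sum>k<m. smult (poly f (of_nat k)) (y ^ (m - 1 - k) * x ^ k))"
    using Suc unfolding g_def x_def y_def .
  also have "y * \<dots> = (\<Sum>k<m. smult (poly f (of_nat k)) (y ^ (Suc m - 1 - k) * x ^ k))"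
    unfolding sum_distrib_left
  proof (rule sum.cong)
    fix k assume "k \<in> {..<m}"
    then have "Suc m - 1 - k = Suc (m - 1 - k)" by auto
    then show "y * smult (poly f (of_nat k)) (y ^ (m - 1 - k) * x ^ k)
      = smult (poly f (of_nat k)) (y ^ (Suc m - 1 - k) * x ^ k)"
      by (simp only: power_Suc mult_smult_right mult.assoc)
  qed simp
  finally show ?case by (simp add: x_def y_def)
qed

theorem theorem4:
  fixes f :: "'a::comm_ring_1 poly" and m :: nat
  assumes "m \<ge> 1"
  shows "[:1, 1:] ^ m * umbral_fubini f - [:0, 1:] ^ m * umbral_fubini (f \<circ>\<^sub>p [:of_nat m, 1:])
       = (\<Sum>k = 0..m - 1. smult (poly f (of_nat k)) ([:1, 1:] ^ (m - 1 - k) * [:0, 1:] ^ k))"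
proof -
  \<comment> \<open>At \<open>m = 0\<close> truncated subtraction would leave \<open>{0}\<close>
    instead of the empty set.\<close>
  have "{0..m - 1} = {..<m}" using assms by auto
  then show ?thesis by (simp only: umbral_fubini_shift)
qed

end
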